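(* Let $\mathfrak{P}_{\mathrm{sg}}=\mathfrak{P}_{\mathrm{sg}}(M,\sigma,\bar K)$ with $M,\sigma>0$, $\bar K\ge2$ fixed. Any active-learning bandit algorithm (i.e. one with $\lim_{T\to\infty}\mathcal R_T/T=0$) has $\mathcal S_T=\omega(\sqrt T)$, i.e. $\mathcal S_T/\sqrt T\to\infty$ as $T\to\infty$.
   Context: Stochastic multi-armed bandit. There are $K$ arms; for each arm $i\in[K]=\{1,\dots,K\}$, $(X^i_s)_{s\ge1}$ is an i.i.d. reward sequence with law $\nu_i$, independent across arms; $\nu=(\nu_1,\dots,\nu_K)$ is the (unknown) bandit instance. For a horizon $T$, an algorithm selects at each time $t\in[T]$ an arm $A_t\sim\pi_t(\cdot\mid\mathcal H_{t-1})$, where $\mathcal H_{t-1}=(A_1,r_1,\dots,A_{t-1},r_{t-1})$ is the observed history, $\pi_t(\cdot\mid \mathcal H_{t-1})$ is a distribution on $[K]$, $N_{i,t}=\sum_{s=1}^t\mathbf 1\{A_s=i\}$, and $r_t=X^{A_t}_{N_{A_t,t}}$. An algorithm thus specifies decision rules $(\pi_t)_{t\in[T]}$ for every horizon $T$ and every number of arms $K$ (the rules may depend on $T$, $K$). Let $\mu_i$ be the mean of $\nu_i$, $\Delta_i=\max_j\mu_j-\mu_i$. Regret: $R_T(\nu)=\sum_{i=1}^K\Delta_i\,\mathbb E[N_{i,T}]$. Allocation variability: $S_T(\nu)=\max_{i\in[K]}\sqrt{\operatorname{Var}(N_{i,T})}$. $\mathfrak{P}_{\mathrm{sg}}(M,\sigma,\bar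 K)$ is the class of instances $\nu=(\nu_1,\dots,\nu_K)$ with $2\le K\le\bar K$ such that each $\nu_i$ has mean $\mu_i\in[-M,M]$ and is $\sigma$-sub-Gaussian. $\mathcal R_T=\sup_{\nu\in\mathfrak{P}_{\mathrm{sg}}}R_T(\nu)$, $\mathcal S_T=\sup_{\nu\in\mathfrak{P}_{\mathrm{sg}}}S_T(\nu)$. Standing assumptions on algorithms: (i) if $\nu_i=\nu_j$ for some $i\ne j$ then $\mathbb E[N_{i,T}]=\mathbb E[N_{j,T}]$; (ii) for $T\ge K$, $\mathbb E[N_{i,T}]\ge1$ for each arm $i$. *)

theory Defs
  imports "HOL-Probability.Probability"
begin

text \<open>
  A bandit instance is a number of arms \<open>K\<close> together with reward laws \<open>\<nu> i\<close> for \<open>i \<in> {1..K}\<close>;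
  the values of \<open>\<nu>\<close> outside \<open>{1..K}\<close> are irrelevant.
\<close>

type_synonym instance_laws = "nat \<Rightarrow> real measure"

text \<open>
  A history is the list \<open>[(A\<^sub>1, r\<^sub>1), \<dots>, (A\<^sub>n, r\<^sub>n)]\<close> of past (arm, reward) pairs, in
  chronological order. A decision rule maps it to the conditional law of \<open>A\<^sub>n\<^sub>+\<^sub>1\<close>, so the time index
  is the length of the history plus one.
\<close>

type_synonym history = "(nat \<times> real) list"
type_synonym decision_rule = "history \<Rightarrow> nat pmf"

text \<open>An algorithm \<open>\<pi>\<close> provides a decision rule \<open>\<pi> T K\<close> for each horizon \<open>T\<close> and number of arms \<open>K\<close>.\<close>

type_synonym algorithm = "nat \<Rightarrow> nat \<Rightarrow> decision_rule"

text \<open>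
  The second conjunct says that each decision rule is a Markov kernel from histories to arms:
  for fixed past arms, the probability of every arm is a Borel function of the past rewards.
\<close>

definition bandit_algorithm :: "algorithm \<Rightarrow> bool" where
  "bandit_algorithm \<pi> \<longleftrightarrow>
     (\<forall>T K. 1 \<le> K \<longrightarrow>
        (\<forall>h. length h < T \<and> fst ` set h \<subseteq> {1..K} \<longrightarrow> set_pmf (\<pi> T K h) \<subseteq> {1..K}) \<and>
        (\<forall>as. length as < T \<and> set as \<subseteq> {1..K} \<longrightarrow>
           (\<forall>a\<in>{1..K}. (\<lambda>r. pmf (\<pi> T K (zip as (map r [0..<length as]))) a)
              \<in> borel_measurable (\<Pi>\<^sub>M s\<in>{..<length as}. (borel :: real measure)))))"

definition reward_table :: "nat \<Rightarrow> instance_laws \<Rightarrow> (nat \<times> nat \<Rightarrow> real) measure" where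
  "reward_table K \<nu> = (\<Pi>\<^sub>M (i, s)\<in>{1..K} \<times> {1..}. \<nu> i)"

definition pulls :: "nat \<Rightarrow> nat list \<Rightarrow> nat" where
  "pulls i as = count_list as i"

text \<open>
  Law of the history after \<open>t\<close> rounds, given the reward table \<open>x\<close> with \<open>x (i, s) = X\<^sup>i\<^sub>s\<close>.
  If arm \<open>a\<close> is chosen after history \<open>h\<close>, this is its pull number \<open>Suc (pulls a (map fst h))\<close>.
\<close>

primrec history_given :: "decision_rule \<Rightarrow> (nat \<times> nat \<Rightarrow> real) \<Rightarrow> nat \<Rightarrow> history pmf" where
  "history_given p x 0 = return_pmf []"
| "history_given p x (Suc t) =
     bind_pmf (history_given p x t) (\<lambda>h.
       map_pmf (\<lambda>a. h @ [(a, x (a, Suc (pulls a (map fst h))))]) (p h))"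

text \<open>
  Law of \<open>[A\<^sub>1, \<dots>, A\<^sub>T]\<close>: the action law given the reward table, averaged over the table. It lives on a
  countable space and determines the joint law of all \<open>N\<^sub>i\<^sub>,\<^sub>T\<close>.
\<close>

definition action_law :: "algorithm \<Rightarrow> nat \<Rightarrow> nat \<Rightarrow> instance_laws \<Rightarrow> nat list measure" where
  "action_law \<pi> T K \<nu> =
     reward_table K \<nu> \<bind> (\<lambda>x. measure_pmf (map_pmf (map fst) (history_given (\<pi> T K) x T)))"

definition expected_pulls :: "algorithm \<Rightarrow> nat \<Rightarrow> nat \<Rightarrow> instance_laws \<Rightarrow> nat \<Rightarrow> real" where
  "expected_pulls \<pi> T K \<nu> i = prob_space.expectation (action_law \<pi> T K \<nu>) (\<lambda>as. real (pulls i as))"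

definition variance_pulls :: "algorithm \<Rightarrow> nat \<Rightarrow> nat \<Rightarrow> instance_laws \<Rightarrow> nat \<Rightarrow> real" where
  "variance_pulls \<pi> T K \<nu> i = prob_space.variance (action_law \<pi> T K \<nu>) (\<lambda>as. real (pulls i as))"

definition mean :: "real measure \<Rightarrow> real" where
  "mean N = (\<integral>x. x \<partial>N)"

definition gap :: "nat \<Rightarrow> instance_laws \<Rightarrow> nat \<Rightarrow> real" where
  "gap K \<nu> i = (MAX j\<in>{1..K}. mean (\<nu> j)) - mean (\<nu> i)"

definition regret :: "algorithm \<Rightarrow> nat \<Rightarrow> nat \<Rightarrow> instance_laws \<Rightarrow> real" where
  "regret \<pi> T K \<nu> = (\<Sum>i\<in>{1..K}. gap K \<nu> i * expected_pulls \<pi> T K \<nu> i)"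

definition variability :: "algorithm \<Rightarrow> nat \<Rightarrow> nat \<Rightarrow> instance_laws \<Rightarrow> real" where
  "variability \<pi> T K \<nu> = (MAX i\<in>{1..K}. sqrt (variance_pulls \<pi> T K \<nu> i))"

definition subgaussian :: "real \<Rightarrow> real measure \<Rightarrow> bool" where
  "subgaussian \<sigma> N \<longleftrightarrow>
     integrable N (\<lambda>x. x) \<and>
     (\<forall>l. integrable N (\<lambda>x. exp (l * (x - mean N))) \<and>
          (\<integral>x. exp (l * (x - mean N)) \<partial>N) \<le> exp (l\<^sup>2 * \<sigma>\<^sup>2 / 2))"

definition P_sg :: "real \<Rightarrow> real \<Rightarrow> nat \<Rightarrow> (nat \<times> instance_laws) set" where
  "P_sg M \<sigma> Kbar =
     {(K, \<nu>). 2 \<le> K \<and> K \<le> Kbar \<and>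
        (\<forall>i\<in>{1..K}. prob_space (\<nu> i) \<and> sets (\<nu> i) = sets borel \<and>
           mean (\<nu> i) \<in> {-M..M} \<and> subgaussian \<sigma> (\<nu> i))}"

text \<open>
  The suprema below are over nonempty bounded sets of reals when \<open>M \<ge> 0\<close> and \<open>Kbar \<ge> 2\<close>: each arm is
  pulled between \<open>0\<close> and \<open>T\<close> times and \<open>T\<close> pulls are made in total, so the regret lies in \<open>[0, 2 M T]\<close>
  and the variability in \<open>[0, T]\<close>.
\<close>

definition sup_regret :: "real \<Rightarrow> real \<Rightarrow> nat \<Rightarrow> algorithm \<Rightarrow> nat \<Rightarrow> real" where
  "sup_regret M \<sigma> Kbar \<pi> T = (SUP (K, \<nu>)\<in>P_sg M \<sigma> Kbar. regret \<pi> T K \<nu>)"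

definition sup_variability :: "real \<Rightarrow> real \<Rightarrow> nat \<Rightarrow> algorithm \<Rightarrow> nat \<Rightarrow> real" where
  "sup_variability M \<sigma> Kbar \<pi> T = (SUP (K, \<nu>)\<in>P_sg M \<sigma> Kbar. variability \<pi> T K \<nu>)"

definition symmetric_on :: "(nat \<times> instance_laws) set \<Rightarrow> algorithm \<Rightarrow> bool" where
  "symmetric_on P \<pi> \<longleftrightarrow>
     (\<forall>(K, \<nu>)\<in>P. \<forall>T. \<forall>i\<in>{1..K}. \<forall>j\<in>{1..K}. i \<noteq> j \<and> \<nu> i = \<nu> j \<longrightarrow>
        expected_pulls \<pi> T K \<nu> i = expected_pulls \<pi> T K \<nu> j)"

definition explores_all_on :: "(nat \<times> instance_laws) set \<Rightarrow> algorithm \<Rightarrow> bool" where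
  "explores_all_on P \<pi> \<longleftrightarrow>
     (\<forall>(K, \<nu>)\<in>P. \<forall>T\<ge>K. \<forall>i\<in>{1..K}. 1 \<le> expected_pulls \<pi> T K \<nu> i)"

definition active_learning :: "real \<Rightarrow> real \<Rightarrow> nat \<Rightarrow> algorithm \<Rightarrow> bool" where
  "active_learning M \<sigma> Kbar \<pi> \<longleftrightarrow> (\<lambda>T. sup_regret M \<sigma> Kbar \<pi> T / real T) \<longlonglongrightarrow> 0"

end

theory Submission
  imports Defs
begin

text \<open>
  Fix arm 1 to a fair coin with values \<open>\<plusminus>b\<close>, where \<open>b = min M \<sigma>\<close>, and let arm 2 show \<open>b\<close> with probability
  \<open>1/2 - \<theta>\<close>. At \<open>\<theta> = 0\<close> symmetry gives \<open>E N\<^sub>2 = T/2\<close>, while at a fixed \<open>\<theta> = \<delta> > 0\<close> sublinear regret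
  forces \<open>E N\<^sub>2 < 3T/8\<close> for large \<open>T\<close>. Changing \<open>\<theta>\<close> by \<open>\<eta> = \<delta>/T\<close> changes the law of the first \<open>T\<close>
  rewards of arm 2 by a chi-square divergence of order \<open>T \<eta>\<^sup>2\<close>, so it changes \<open>E N\<^sub>2\<close> by at most
  \<open>\<eta>/2 \<sqdot> Var N\<^sub>2 + 8 T \<eta>\<close>. If all standard deviations were at most \<open>Z \<surd>T\<close>, the \<open>T\<close> steps from \<open>0\<close> to \<open>\<delta>\<close>
  would add up to at most \<open>\<delta> T (Z\<^sup>2/2 + 8)\<close>, which is too little once \<open>\<delta>\<close> is small in terms of \<open>Z\<close>.
\<close>

section \<open>Action sequences under a reward table\<close>

text \<open>With the table fixed, rewards are a function of the actions: each round reads the cell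
  indexed by one plus the number of earlier pulls of its arm, as reward indices start at 1. The
  \<open>zip\<close> shape matches the measurability clause of
  \<open>bandit_algorithm\<close>.\<close>

definition played_history :: "(nat \<times> nat \<Rightarrow> real) \<Rightarrow> nat list \<Rightarrow> history" where
  "played_history x as =
     zip as (map (\<lambda>k. x (as ! k, Suc (pulls (as ! k) (take k as)))) [0..<length as])"

primrec actions_given :: "decision_rule \<Rightarrow> (nat \<times> nat \<Rightarrow> real) \<Rightarrow> nat \<Rightarrow> nat list pmf" where
  "actions_given p x 0 = return_pmf []"
| "actions_given p x (Suc t) =
     bind_pmf (actions_given p x t) (\<lambda>as. map_pmf (\<lambda>a. as @ [a]) (p (played_history x as)))"

definition action_seqs :: "nat \<Rightarrow> nat \<Rightarrow> nat list set" where
  "action_seqs K t = {as. set as \<subseteq> {1..K} \<and> length as = t}"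

lemma finite_action_seqs [simp]: "finite (action_seqs K t)"
  unfolding action_seqs_def by (rule finite_lists_length_eq) simp

lemma map_fst_played_history [simp]: "map fst (played_history x as) = as"
  by (simp add: played_history_def)

lemma length_played_history [simp]: "length (played_history x as) = length as"
  by (simp add: played_history_def)

lemma fst_set_played_history [simp]: "fst ` set (played_history x as) = set as"
  by (metis list.set_map map_fst_played_history)

lemma played_history_Nil [simp]: "played_history x [] = []"
  by (simp add: played_history_def)

lemma played_history_snoc:
  "played_history x (as @ [a]) = played_history x as @ [(a, x (a, Suc (pulls a as)))]"
proof -
  define f where "f bs k = x (bs ! k, Suc (pulls (bs ! k) (take k bs)))" for bs k
  have "map (f (as @ [a])) [0..<length as] = map (f as) [0..<length as]"
    by (rule map_cong) (auto simp: nth_append f_def)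
  then have "played_history x (as @ [a]) = zip as (map (f as) [0..<length as]) @ [(a, f (as @ [a]) (length as))]"
    unfolding played_history_def f_def[symmetric] by (simp del: map_eq_conv)
  then show ?thesis
    unfolding played_history_def[of x as] f_def by simp
qed

text \<open>Only the choice of arms is random once the table is given, so histories can be traded
  for action lists, which range over a finite set.\<close>

lemma history_given_eq:
  "history_given p x t = map_pmf (played_history x) (actions_given p x t)"
  by (induction t)
     (simp_all add: bind_map_pmf map_bind_pmf map_pmf_comp played_history_snoc)

lemma map_fst_history_given: "map_pmf (map fst) (history_given p x t) = actions_given p x t"
  by (simp add: history_given_eq map_pmf_comp)

text \<open>A list ending in \<open>a\<close> extends exactly one shorter list, so the mixture over
  predecessors collapses to a single product.\<close>

lemma pmf_actions_given_snoc:
  "pmf (actions_given p x (Suc t)) (as @ [a]) =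
     pmf (actions_given p x t) as * pmf (p (played_history x as)) a"
proof -
  have "pmf (map_pmf (\<lambda>b. bs @ [b]) (p (played_history x bs))) (as @ [a])
        = indicator {as} bs * pmf (p (played_history x as)) a" for bs
  proof (cases "bs = as")
    case True
    have "inj (\<lambda>b. as @ [b])" by (simp add: inj_def)
    then show ?thesis using True pmf_map_inj'[of "\<lambda>b. as @ [b]" "p (played_history x as)" a] by simp
  next
    case False
    then show ?thesis by (simp add: pmf_map_outside image_iff)
  qed
  then show ?thesis
    by (simp add: pmf_bind measure_pmf_single)
qed

lemma pulls_le_length: "pulls i as \<le> length as"
  by (simp add: pulls_def count_le_length)

lemma sum_pulls:
  assumes "as \<in> action_seqs K t" shows "(\<Sum>i\<in>{1..K}. pulls i as) = t"
  using assms sum_count_set[of as "{1..K}"] by (simp add: action_seqs_def pulls_def)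

lemma pulls_take_bound:
  assumes "k < length as" shows "Suc (pulls i (take k as)) \<le> length as"
  using pulls_le_length[of i "take k as"] assms by simp

lemma played_history_cong:
  assumes "\<And>i s. i \<in> set as \<Longrightarrow> 1 \<le> s \<Longrightarrow> s \<le> length as \<Longrightarrow> x (i, s) = y (i, s)"
  shows "played_history x as = played_history y as"
  unfolding played_history_def
proof (intro arg_cong2[where f = zip] refl map_cong)
  fix k assume "k \<in> set [0..<length as]"
  then show "x (as ! k, Suc (pulls (as ! k) (take k as))) = y (as ! k, Suc (pulls (as ! k) (take k as)))"
    using pulls_take_bound[of k as "as ! k"] by (intro assms) auto
qed

text \<open>The decisions along \<open>as\<close> consult only rewards already seen, and no arm has
  been pulled more than \<open>length as\<close> times. This is what later permits the truncation of
  the table.\<close>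

lemma pmf_actions_given_cong:
  assumes "\<And>i s. i \<in> set as \<Longrightarrow> 1 \<le> s \<Longrightarrow> s \<le> length as \<Longrightarrow> x (i, s) = y (i, s)"
  shows "pmf (actions_given p x (length as)) as = pmf (actions_given p y (length as)) as"
  using assms
proof (induction as rule: rev_induct)
  case (snoc a as)
  have "played_history x as = played_history y as"
    by (rule played_history_cong) (use snoc.prems in auto)
  then show ?case
    using snoc by (simp add: pmf_actions_given_snoc del: actions_given.simps)
qed simp

section \<open>Support and measurability of the action law given the table\<close>

locale bandit_rule =
  fixes \<pi> :: algorithm and T K :: nat
  assumes alg: "bandit_algorithm \<pi>" and K: "1 \<le> K"
begin

abbreviation "acts x \<equiv> actions_given (\<pi> T K) x"

lemma set_rule:
  "length h < T \<Longrightarrow> fst ` set h \<subseteq> {1..K} \<Longrightarrow> set_pmf (\<pi> T K h) \<subseteq> {1..K}"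
  using alg K unfolding bandit_algorithm_def by blast

lemma rule_measurable:
  assumes "length as < T" "set as \<subseteq> {1..K}" "a \<in> {1..K}"
  shows "(\<lambda>r. pmf (\<pi> T K (zip as (map r [0..<length as]))) a)
           \<in> borel_measurable (\<Pi>\<^sub>M s\<in>{..<length as}. (borel :: real measure))"
  using alg K assms unfolding bandit_algorithm_def by blast

lemma set_acts:
  assumes "t \<le> T" shows "set_pmf (acts x t) \<subseteq> action_seqs K t"
  using assms
proof (induction t)
  case (Suc t)
  then have IH: "set_pmf (acts x t) \<subseteq> action_seqs K t" by simp
  have "as @ [a] \<in> action_seqs K (Suc t)"
    if "as \<in> set_pmf (acts x t)" "a \<in> set_pmf (\<pi> T K (played_history x as))" for as a
  proof -
    have "as \<in> action_seqs K t" using that IH by blast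
    moreover from this have "a \<in> {1..K}"
      using set_rule[of "played_history x as"] that(2) Suc.prems by (auto simp: action_seqs_def)
    ultimately show ?thesis by (auto simp: action_seqs_def)
  qed
  then show ?case by auto
qed (simp add: action_seqs_def)

text \<open>Induction along the product formula for one more action. The index set \<open>I\<close>
  is left open so that the result serves both the infinite table and its truncation.\<close>

lemma pmf_acts_measurable:
  assumes "length as \<le> T" "set as \<subseteq> {1..K}"
    and I: "{1..K} \<times> {1..length as} \<subseteq> I"
  shows "(\<lambda>x. pmf (acts x (length as)) as) \<in> borel_measurable (\<Pi>\<^sub>M j\<in>I. (borel :: real measure))"
  using assms
proof (induction as rule: rev_induct)
  case (snoc a as)
  define n where "n = length as"
  define idx where "idx k = (as ! k, Suc (pulls (as ! k) (take k as)))" for k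
  have idx: "idx k \<in> I" if "k < n" for k
  proof -
    have "as ! k \<in> set as" using that by (simp add: n_def)
    then have "as ! k \<in> {1..K}" using snoc.prems by auto
    moreover have "Suc (pulls (as ! k) (take k as)) \<le> Suc n"
      using pulls_take_bound[of k as "as ! k"] that by (simp add: n_def)
    ultimately have "idx k \<in> {1..K} \<times> {1..length (as @ [a])}"
      unfolding idx_def n_def by simp
    then show ?thesis by (rule subsetD[OF snoc.prems(3)])
  qed
  \<comment> \<open>For fixed \<open>as\<close> the cell read in each round does not depend on
    \<open>x\<close>, so the reward vector is a tuple of coordinate projections that can be fed to
    the kernel.\<close>
  have rows: "(\<lambda>x. \<lambda>k\<in>{..<n}. x (idx k))
      \<in> measurable (\<Pi>\<^sub>M j\<in>I. (borel :: real measure)) (\<Pi>\<^sub>M s\<in>{..<n}. (borel :: real measure))"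
    by (intro measurable_restrict measurable_component_singleton idx) simp
  have hist: "zip as (map (\<lambda>k\<in>{..<n}. x (idx k)) [0..<length as]) = played_history x as" for x
  proof -
    have "map (\<lambda>k\<in>{..<n}. x (idx k)) [0..<length as] = map (\<lambda>k. x (idx k)) [0..<length as]"
      by (rule map_cong) (auto simp: n_def)
    then show ?thesis by (simp only: played_history_def idx_def)
  qed
  have "(\<lambda>r. pmf (\<pi> T K (zip as (map r [0..<length as]))) a)
      \<in> borel_measurable (\<Pi>\<^sub>M s\<in>{..<n}. (borel :: real measure))"
    unfolding n_def by (rule rule_measurable) (use snoc.prems in auto)
  from measurable_compose[OF rows this]
  have "(\<lambda>x. pmf (\<pi> T K (played_history x as)) a) \<in> borel_measurable (\<Pi>\<^sub>M j\<in>I. borel)"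
    unfolding hist .
  moreover have "(\<lambda>x. pmf (acts x (length as)) as) \<in> borel_measurable (\<Pi>\<^sub>M j\<in>I. borel)"
  proof (rule snoc.IH)
    show "{1..K} \<times> {1..length as} \<subseteq> I"
      by (rule order_trans[OF _ snoc.prems(3)]) auto
  qed (use snoc.prems in auto)
  ultimately have "(\<lambda>x. pmf (acts x (length as)) as * pmf (\<pi> T K (played_history x as)) a)
      \<in> borel_measurable (\<Pi>\<^sub>M j\<in>I. borel)"
    by (rule borel_measurable_times[rotated])
  then show ?case
    by (simp add: pmf_actions_given_snoc del: actions_given.simps)
qed simp

end

section \<open>The action law averaged over the reward table, as a finite sum\<close>

locale bandit_run = bandit_rule +
  fixes \<nu> :: instance_laws
  assumes prob_law: "\<And>i. i \<in> {1..K} \<Longrightarrow> prob_space (\<nu> i)"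
    and sets_law: "\<And>i. i \<in> {1..K} \<Longrightarrow> sets (\<nu> i) = sets borel"
begin

abbreviation "table \<equiv> reward_table K \<nu>"
abbreviation "law \<equiv> action_law \<pi> T K \<nu>"

lemma prob_space_table: "prob_space table"
  unfolding reward_table_def by (rule prob_space_PiM) (auto intro: prob_law)

lemma sets_table: "sets table = sets (\<Pi>\<^sub>M j\<in>{1..K} \<times> {1..}. (borel :: real measure))"
  unfolding reward_table_def by (rule sets_PiM_cong) (auto simp: sets_law)

lemma pmf_acts_table [measurable]:
  assumes "as \<in> action_seqs K T"
  shows "(\<lambda>x. pmf (acts x T) as) \<in> borel_measurable table"
proof -
  have "(\<lambda>x. pmf (acts x T) as) \<in> borel_measurable (\<Pi>\<^sub>M j\<in>{1..K} \<times> {1..}. (borel :: real measure))"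
    using pmf_acts_measurable[of as "{1..K} \<times> {1..}"] assms
    by (simp add: action_seqs_def Sigma_mono subset_eq)
  then show ?thesis using measurable_cong_sets[OF sets_table refl] by blast
qed

lemma sum_acts: "(\<Sum>as\<in>action_seqs K T. pmf (acts x T) as) = 1"
  by (rule sum_pmf_eq_1[OF finite_action_seqs set_acts[OF order.refl]])

lemma law_eq: "law = table \<bind> (\<lambda>x. measure_pmf (acts x T))"
  by (simp add: action_law_def map_fst_history_given)

text \<open>All mass lies on the finite set \<open>action_seqs K T\<close>, so the measure of any
  set is a finite sum of measurable point masses.\<close>

lemma acts_kernel:
  "(\<lambda>x. measure_pmf (acts x T)) \<in> measurable table (subprob_algebra (count_space UNIV))"
proof (rule measurable_subprob_algebra)
  fix A :: "nat list set"
  have "emeasure (measure_pmf (acts x T)) A = (\<Sum>as\<in>A \<inter> action_seqs K T. ennreal (pmf (acts x T) as))" for x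
  proof -
    have "emeasure (measure_pmf (acts x T)) A = emeasure (measure_pmf (acts x T)) (A \<inter> action_seqs K T)"
      using set_acts[of T x] by (intro emeasure_eq_AE) (auto simp: AE_measure_pmf_iff)
    also have "\<dots> = ennreal (\<Sum>as\<in>A \<inter> action_seqs K T. pmf (acts x T) as)"
      by (rule emeasure_measure_pmf_finite) simp
    finally show ?thesis by (simp add: sum_ennreal)
  qed
  moreover have "(\<lambda>x. \<Sum>as\<in>A \<inter> action_seqs K T. ennreal (pmf (acts x T) as)) \<in> borel_measurable table"
    by (intro borel_measurable_sum measurable_compose[OF _ measurable_ennreal] pmf_acts_table) auto
  ultimately show "(\<lambda>x. emeasure (measure_pmf (acts x T)) A) \<in> borel_measurable table"
    by simp
qed (simp_all add: measure_pmf.subprob_space_axioms)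

lemma sets_law_eq: "sets law = UNIV"
  unfolding law_eq using prob_space.not_empty[OF prob_space_table]
  by (subst sets_bind[where N = "count_space UNIV"]) auto

lemma prob_space_action_law: "prob_space law"
  unfolding law_eq
  by (rule prob_space.prob_space_bind[OF prob_space_table _ acts_kernel])
     (simp add: measure_pmf.prob_space_axioms)

text \<open>These are the point masses of the averaged law (\<open>measure_law\<close>); they turn
  every expectation into a finite sum.\<close>

definition weight :: "nat list \<Rightarrow> real" where
  "weight as = (\<integral>x. pmf (acts x T) as \<partial>table)"

lemma integrable_acts:
  assumes "as \<in> action_seqs K T" shows "integrable table (\<lambda>x. pmf (acts x T) as)"
proof -
  interpret table: prob_space table by (rule prob_space_table)
  show ?thesis
    by (rule table.integrable_const_bound[where B = 1]) (simp_all add: pmf_le_1 pmf_acts_table assms)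
qed

lemma weight_nonneg: "0 \<le> weight as"
  by (simp add: weight_def)

lemma sum_weight: "(\<Sum>as\<in>action_seqs K T. weight as) = 1"
proof -
  have "(\<Sum>as\<in>action_seqs K T. weight as)
      = (\<integral>x. (\<Sum>as\<in>action_seqs K T. pmf (acts x T) as) \<partial>table)"
    unfolding weight_def by (rule Bochner_Integration.integral_sum[symmetric]) (rule integrable_acts)
  then show ?thesis
    using prob_space_table by (simp add: sum_acts prob_space.prob_space)
qed

lemma AE_law: "AE as in law. as \<in> action_seqs K T"
  unfolding law_eq using set_acts[OF order.refl]
  by (subst AE_bind[OF acts_kernel]) (auto simp: AE_measure_pmf_iff subset_iff)

lemma measure_law: "measure law {as} = weight as"
proof -
  interpret table: prob_space table by (rule prob_space_table)
  show ?thesis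
    unfolding law_eq weight_def
    by (simp add: table.measure_bind[OF acts_kernel] measure_pmf_single)
qed

text \<open>Almost surely the action list lies in a finite set, where \<open>h\<close> agrees with a
  finite combination of indicators of singletons.\<close>

lemma expectation_law:
  "prob_space.expectation law h = (\<Sum>as\<in>action_seqs K T. h as * weight as)" for h :: "nat list \<Rightarrow> real"
proof -
  interpret law: prob_space law by (rule prob_space_action_law)
  have *: "law.expectation h
    = law.expectation (\<lambda>y. \<Sum>as\<in>action_seqs K T. h as * indicator {as} y)"
  proof (rule integral_cong_AE)
    show "AE y in law. h y = (\<Sum>as\<in>action_seqs K T. h as * indicator {as} y)"
      using AE_law
    proof eventually_elim
      case (elim y)
      then show ?case
        by (subst sum.remove[of _ y]) (auto intro!: sum.neutral simp: indicator_def)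
    qed
  qed (auto simp: measurable_def sets_law_eq)
  show ?thesis
    unfolding * by (subst Bochner_Integration.integral_sum)
      (auto simp: measure_law sets_law_eq law.emeasure_eq_measure)
qed

lemma expected_pulls_eq:
  "expected_pulls \<pi> T K \<nu> i = (\<Sum>as\<in>action_seqs K T. real (pulls i as) * weight as)"
  by (simp add: expected_pulls_def expectation_law)

lemma variance_pulls_eq:
  "variance_pulls \<pi> T K \<nu> i =
     (\<Sum>as\<in>action_seqs K T. (real (pulls i as) - expected_pulls \<pi> T K \<nu> i)\<^sup>2 * weight as)"
  by (simp add: variance_pulls_def expectation_law[of "\<lambda>as. (real (pulls i as) - _)\<^sup>2"] expected_pulls_def)

lemma expectation_bounds:
  assumes "\<And>as. as \<in> action_seqs K T \<Longrightarrow> 0 \<le> h as \<and> h as \<le> c"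
  shows "0 \<le> (\<Sum>as\<in>action_seqs K T. h as * weight as)"
    and "(\<Sum>as\<in>action_seqs K T. h as * weight as) \<le> c"
proof -
  show "0 \<le> (\<Sum>as\<in>action_seqs K T. h as * weight as)"
    using assms weight_nonneg by (intro sum_nonneg) auto
  have "(\<Sum>as\<in>action_seqs K T. h as * weight as) \<le> (\<Sum>as\<in>action_seqs K T. c * weight as)"
    using assms weight_nonneg by (intro sum_mono mult_right_mono) auto
  also have "\<dots> = c" by (simp add: sum_weight flip: sum_distrib_left)
  finally show "(\<Sum>as\<in>action_seqs K T. h as * weight as) \<le> c" .
qed

lemma expected_pulls_bounds: "0 \<le> expected_pulls \<pi> T K \<nu> i" "expected_pulls \<pi> T K \<nu> i \<le> real T"
proof -
  have "0 \<le> real (pulls i as) \<and> real (pulls i as) \<le> real T" if "as \<in> action_seqs K T" for as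
    using pulls_le_length[of i as] that by (simp add: action_seqs_def)
  from expectation_bounds[where h = "\<lambda>as. real (pulls i as)", OF this]
  show "0 \<le> expected_pulls \<pi> T K \<nu> i" "expected_pulls \<pi> T K \<nu> i \<le> real T"
    unfolding expected_pulls_eq by blast+
qed

lemma variance_pulls_bounds: "0 \<le> variance_pulls \<pi> T K \<nu> i" "variance_pulls \<pi> T K \<nu> i \<le> (real T)\<^sup>2"
proof -
  have "(real (pulls i as) - expected_pulls \<pi> T K \<nu> i)\<^sup>2 \<le> (real T)\<^sup>2" if "as \<in> action_seqs K T" for as
    using expected_pulls_bounds[of i] pulls_le_length[of i as] that
    by (intro power2_le_iff_abs_le[THEN iffD2]) (auto simp: action_seqs_def abs_le_iff)
  then have "0 \<le> (real (pulls i as) - expected_pulls \<pi> T K \<nu> i)\<^sup>2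
      \<and> (real (pulls i as) - expected_pulls \<pi> T K \<nu> i)\<^sup>2 \<le> (real T)\<^sup>2" if "as \<in> action_seqs K T" for as
    using that by simp
  from expectation_bounds[where h = "\<lambda>as. (real (pulls i as) - expected_pulls \<pi> T K \<nu> i)\<^sup>2", OF this]
  show "0 \<le> variance_pulls \<pi> T K \<nu> i" "variance_pulls \<pi> T K \<nu> i \<le> (real T)\<^sup>2"
    unfolding variance_pulls_eq by blast+
qed

lemma sum_expected_pulls: "(\<Sum>i\<in>{1..K}. expected_pulls \<pi> T K \<nu> i) = real T"
proof -
  have "(\<Sum>i\<in>{1..K}. expected_pulls \<pi> T K \<nu> i)
      = (\<Sum>as\<in>action_seqs K T. real (\<Sum>i\<in>{1..K}. pulls i as) * weight as)"
    unfolding expected_pulls_eq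
    by (subst sum.swap) (simp add: sum_distrib_right)
  also have "\<dots> = (\<Sum>as\<in>action_seqs K T. real T * weight as)"
    by (intro sum.cong refl) (simp only: sum_pulls)
  also have "\<dots> = real T" by (simp add: sum_weight flip: sum_distrib_left)
  finally show ?thesis .
qed

end

section \<open>Change of measure\<close>

text \<open>A finite product measure is determined by its values on rectangles, and there the
  integral of a product of one-coordinate functions factorises. It makes the likelihood ratio of two
  tables a product of ratios of single rewards.\<close>

lemma density_PiM:
  fixes M :: "'i \<Rightarrow> 'a measure"
  assumes J: "finite J"
    and M: "\<And>j. prob_space (M j)" and M': "\<And>j. prob_space (density (M j) (l j))"
    and l [measurable]: "\<And>j. l j \<in> borel_measurable (M j)"
  shows "PiM J (\<lambda>j. density (M j) (l j)) = density (PiM J M) (\<lambda>x. \<Prod>j\<in>J. l j (x j))"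
proof -
  interpret M: product_sigma_finite M
    by (simp add: product_sigma_finite_def M prob_space_imp_sigma_finite)
  interpret M': product_sigma_finite "\<lambda>j. density (M j) (l j)"
    by (simp add: product_sigma_finite_def M' prob_space_imp_sigma_finite)
  have prod_meas [measurable]: "(\<lambda>x. \<Prod>j\<in>J. l j (x j)) \<in> borel_measurable (PiM J M)"
  proof (rule borel_measurable_prod_ennreal)
    fix j assume "j \<in> J"
    then show "(\<lambda>x. l j (x j)) \<in> borel_measurable (PiM J M)"
      by (rule measurable_compose[OF measurable_component_singleton[where M = M] l])
  qed
  show ?thesis
  proof (rule M'.PiM_eqI[symmetric])
    show "sets (density (PiM J M) (\<lambda>x. \<Prod>j\<in>J. l j (x j))) = sets (PiM J (\<lambda>j. density (M j) (l j)))"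
      by (simp cong: sets_PiM_cong)
  next
    fix A assume "\<And>j. j \<in> J \<Longrightarrow> A j \<in> sets (density (M j) (l j))"
    then have A: "\<And>j. j \<in> J \<Longrightarrow> A j \<in> sets (M j)" by simp
    have "emeasure (density (PiM J M) (\<lambda>x. \<Prod>j\<in>J. l j (x j))) (Pi\<^sub>E J A)
        = (\<integral>\<^sup>+x. (\<Prod>j\<in>J. l j (x j)) * indicator (Pi\<^sub>E J A) x \<partial>PiM J M)"
      using J A by (intro emeasure_density prod_meas sets_PiM_I_finite)
    also have "\<dots> = (\<integral>\<^sup>+x. (\<Prod>j\<in>J. l j (x j) * indicator (A j) (x j)) \<partial>PiM J M)"
    proof (rule nn_integral_cong)
      fix x assume "x \<in> space (PiM J M)"
      then have "x \<in> extensional J" by (simp add: space_PiM PiE_def)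
      then have "indicator (Pi\<^sub>E J A) x = (\<Prod>j\<in>J. indicator (A j) (x j) :: ennreal)"
        using J by (auto simp: indicator_def PiE_iff prod_zero_iff)
      then show "(\<Prod>j\<in>J. l j (x j)) * indicator (Pi\<^sub>E J A) x = (\<Prod>j\<in>J. l j (x j) * indicator (A j) (x j))"
        by (simp add: prod.distrib)
    qed
    also have "\<dots> = (\<Prod>j\<in>J. \<integral>\<^sup>+y. l j y * indicator (A j) y \<partial>M j)"
      using J A by (intro M.product_nn_integral_prod) auto
    also have "\<dots> = (\<Prod>j\<in>J. emeasure (density (M j) (l j)) (A j))"
      using A by (intro prod.cong refl) (simp add: emeasure_density)
    finally show "emeasure (density (PiM J M) (\<lambda>x. \<Prod>j\<in>J. l j (x j))) (Pi\<^sub>E J A)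
      = (\<Prod>j\<in>J. emeasure (density (M j) (l j)) (A j))" .
  qed (rule J)
qed

section \<open>Truncation to the first \<open>T\<close> rewards of each arm, and the
  likelihood-ratio bound\<close>

context bandit_run
begin

text \<open>The point mass at 0 fills the indices outside the arms, since the product locales ask
  for a probability measure at every index.\<close>

definition cell_law :: "nat \<times> nat \<Rightarrow> real measure" where
  "cell_law j = (if fst j \<in> {1..K} then \<nu> (fst j) else return borel 0)"

abbreviation "cells \<equiv> {1..K} \<times> {1..T}"

lemma prob_space_cell_law: "prob_space (cell_law j)"
  by (simp add: cell_law_def prob_law prob_space_return del: One_nat_def)

lemma sets_cell_law: "sets (cell_law j) = sets borel"
  by (simp add: cell_law_def sets_law)

lemma product_prob_space_cell_law: "product_prob_space cell_law"
  by (intro product_prob_space.intro product_prob_space_axioms.intro product_sigma_finite.intro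
      prob_space_cell_law prob_space_imp_sigma_finite)

lemma table_eq: "table = PiM ({1..K} \<times> {1..}) cell_law"
  unfolding reward_table_def by (rule PiM_cong) (auto simp: cell_law_def)

lemma sets_cells: "sets (PiM cells cell_law) = sets (\<Pi>\<^sub>M j\<in>cells. (borel :: real measure))"
  by (rule sets_PiM_cong) (simp_all add: sets_cell_law)

lemma pmf_acts_cells:
  assumes "as \<in> action_seqs K T"
  shows "(\<lambda>x. pmf (acts x T) as) \<in> borel_measurable (PiM cells cell_law)"
proof -
  have "(\<lambda>x. pmf (acts x T) as) \<in> borel_measurable (\<Pi>\<^sub>M j\<in>cells. (borel :: real measure))"
    using pmf_acts_measurable[of as cells] assms by (simp add: action_seqs_def)
  then show ?thesis using measurable_cong_sets[OF sets_cells refl] by blast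
qed

text \<open>No arm is pulled more than \<open>T\<close> times, so restricting the table changes no
  probability, and the marginal of the infinite product is the finite one. Infinite i.i.d. products
  of distinct laws are mutually singular, so a density is available only after this
  truncation.\<close>

lemma weight_eq_cells:
  assumes as: "as \<in> action_seqs K T"
  shows "weight as = (\<integral>x. pmf (acts x T) as \<partial>PiM cells cell_law)"
proof -
  let ?I = "{1..K} \<times> {1..} :: (nat \<times> nat) set"
  interpret product_prob_space cell_law ?I by (rule product_prob_space_cell_law)
  have sub: "cells \<subseteq> ?I" by auto
  have "(\<integral>x. pmf (acts x T) as \<partial>PiM cells cell_law)
      = (\<integral>x. pmf (acts x T) as \<partial>distr (PiM ?I cell_law) (PiM cells cell_law) (\<lambda>x. restrict x cells))"
    by (subst distr_PiM_restrict_finite[OF _ sub]) simp_all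
  also have "\<dots> = (\<integral>x. pmf (acts (restrict x cells) T) as \<partial>PiM ?I cell_law)"
    by (rule integral_distr[OF measurable_restrict_subset[OF sub] pmf_acts_cells[OF as]])
  also have "\<dots> = (\<integral>x. pmf (acts x T) as \<partial>PiM ?I cell_law)"
  proof (rule Bochner_Integration.integral_cong[OF refl])
    fix x :: "nat \<times> nat \<Rightarrow> real"
    have "pmf (acts (restrict x cells) (length as)) as = pmf (acts x (length as)) as"
      using as by (intro pmf_actions_given_cong) (auto simp: action_seqs_def)
    then show "pmf (acts (restrict x cells) T) as = pmf (acts x T) as"
      using as by (simp add: action_seqs_def)
  qed
  finally show ?thesis by (simp add: weight_def table_eq)
qed

text \<open>
  Only the first \<open>T\<close> rewards of each arm matter, so the likelihood ratio \<open>L\<close> of the truncated tables can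
  be used; its chi-square divergence tensorises. The inequality
  \<open>2 u v \<le> lam u\<^sup>2 + v\<^sup>2 / lam\<close> for \<open>u = h - c\<close> and \<open>v = 1 - L\<close> plays the role of Cauchy-Schwarz.
\<close>

lemma change_of_measure:
  fixes h :: "nat list \<Rightarrow> real"
  assumes run': "bandit_run \<pi> K \<nu>'"
    and dens: "\<And>i. i \<in> {1..K} \<Longrightarrow> \<nu>' i = density (\<nu> i) (\<lambda>x. ennreal (l i x))"
    and l [measurable]: "\<And>i. l i \<in> borel_measurable borel"
    and l0: "\<And>i x. 0 \<le> l i x"
    and l2: "\<And>i. i \<in> {1..K} \<Longrightarrow> integrable (\<nu> i) (\<lambda>x. (l i x)\<^sup>2)"
    and lam: "0 < lam"
  shows "(\<Sum>as\<in>action_seqs K T. h as * weight as)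
       - (\<Sum>as\<in>action_seqs K T. h as * bandit_run.weight \<pi> T K \<nu>' as)
     \<le> lam / 2 * (\<Sum>as\<in>action_seqs K T. (h as - c)\<^sup>2 * weight as)
       + ((\<Prod>i\<in>{1..K}. \<integral>x. (l i x)\<^sup>2 \<partial>\<nu> i) ^ T - 1) / (2 * lam)"
proof -
  note One_nat_def [simp del]
  interpret run': bandit_run \<pi> T K \<nu>' by (rule run')
  interpret product_prob_space cell_law cells by (rule product_prob_space_cell_law)
  let ?P = "PiM cells cell_law" and ?S = "action_seqs K T"
  \<comment> \<open>The value 1 off the arms fits the default law there, which both instances
    share.\<close>
  define r where "r j = (if fst j \<in> {1..K} then l (fst j) else (\<lambda>_. 1))" for j :: "nat \<times> nat"
  define L where "L x = (\<Prod>j\<in>cells. r j (x j))" for x :: "nat \<times> nat \<Rightarrow> real"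
  have r0: "0 \<le> r j y" for j y by (simp add: r_def l0)
  have r_borel [measurable]: "r j \<in> borel_measurable borel" for j by (simp add: r_def)
  have r_meas [measurable]: "r j \<in> borel_measurable (cell_law j)" for j
    using r_borel[of j] measurable_cong_sets[OF sets_cell_law refl] by blast
  have cell': "run'.cell_law j = density (cell_law j) (\<lambda>y. ennreal (r j y))" for j
  proof (cases "fst j \<in> {1..K}")
    case True
    then show ?thesis by (simp add: run'.cell_law_def cell_law_def r_def dens)
  next
    case False
    then show ?thesis
      unfolding run'.cell_law_def cell_law_def r_def if_not_P[OF False] by (simp add: density_1)
  qed
  have L_meas [measurable]: "L \<in> borel_measurable ?P"
    unfolding L_def
  proof (rule borel_measurable_prod)
    fix j assume "j \<in> cells"
    then show "(\<lambda>x. r j (x j)) \<in> borel_measurable ?P"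
      by (rule measurable_compose[OF measurable_component_singleton[where M = cell_law] r_meas])
  qed
  have L0: "0 \<le> L x" for x by (simp add: L_def prod_nonneg r0)
  have PiM': "PiM cells run'.cell_law = density ?P (\<lambda>x. ennreal (L x))"
  proof -
    have "PiM cells run'.cell_law = PiM cells (\<lambda>j. density (cell_law j) (\<lambda>y. ennreal (r j y)))"
      by (rule PiM_cong) (simp_all add: cell')
    also have "\<dots> = density ?P (\<lambda>x. \<Prod>j\<in>cells. ennreal (r j (x j)))"
    proof (rule density_PiM)
      show "prob_space (density (cell_law j) (\<lambda>y. ennreal (r j y)))" for j
        using run'.prob_space_cell_law[of j] by (simp add: cell')
    qed (simp_all add: prob_space_cell_law)
    finally show ?thesis by (simp add: L_def prod_ennreal r0)
  qed
  have r2_int: "integrable (cell_law j) (\<lambda>y. (r j y)\<^sup>2)" for j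
  proof (cases "fst j \<in> {1..K}")
    case True
    then show ?thesis using l2[of "fst j"] by (simp add: cell_law_def r_def)
  next
    case False
    interpret cell: prob_space "cell_law j" by (rule prob_space_cell_law)
    show ?thesis unfolding r_def if_not_P[OF False] by simp
  qed
  have L2_eq: "(L x)\<^sup>2 = (\<Prod>j\<in>cells. (r j (x j))\<^sup>2)" for x
    by (simp add: L_def prod_power_distrib)
  have L2_int: "integrable ?P (\<lambda>x. (L x)\<^sup>2)"
    unfolding L2_eq by (rule product_integrable_prod) (simp_all add: r2_int)
  have L2: "(\<integral>x. (L x)\<^sup>2 \<partial>?P) = (\<Prod>i\<in>{1..K}. \<integral>x. (l i x)\<^sup>2 \<partial>\<nu> i) ^ T"
  proof -
    have "(\<integral>x. (L x)\<^sup>2 \<partial>?P) = (\<Prod>j\<in>cells. \<integral>y. (r j y)\<^sup>2 \<partial>cell_law j)"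
      unfolding L2_eq by (rule product_integral_prod) (simp_all add: r2_int)
    also have "\<dots> = (\<Prod>(i, s)\<in>cells. \<integral>x. (l i x)\<^sup>2 \<partial>\<nu> i)"
      by (rule prod.cong) (auto simp: cell_law_def r_def)
    also have "\<dots> = (\<Prod>i\<in>{1..K}. \<Prod>s\<in>{1..T}. \<integral>x. (l i x)\<^sup>2 \<partial>\<nu> i)"
      by (rule prod.cartesian_product[symmetric])
    also have "\<dots> = (\<Prod>i\<in>{1..K}. \<integral>x. (l i x)\<^sup>2 \<partial>\<nu> i) ^ T"
      by (simp add: prod_power_distrib)
    finally show ?thesis .
  qed
  have L_int: "integrable ?P L"
    by (rule P.square_integrable_imp_integrable[OF L_meas L2_int])
  \<comment> \<open>The total mass of the second product measure, computed through its
    density.\<close>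
  have EL: "(\<integral>x. L x \<partial>?P) = 1"
  proof -
    interpret P': prob_space "PiM cells run'.cell_law"
      by (rule prob_space_PiM) (rule run'.prob_space_cell_law)
    have "(\<integral>x. 1 \<partial>PiM cells run'.cell_law) = (\<integral>x. L x * 1 \<partial>?P)"
      unfolding PiM' by (rule integral_real_density) (simp_all add: L0 L_meas)
    then show ?thesis using P'.prob_space by simp
  qed
  define q where "q as x = pmf (acts x T) as" for as x
  have q_meas [measurable]: "q as \<in> borel_measurable ?P" if "as \<in> ?S" for as
    using pmf_acts_cells[OF that] by (simp add: q_def[abs_def])
  have q01: "0 \<le> q as x" "q as x \<le> 1" for as x by (simp_all add: q_def pmf_le_1)
  have q_int: "integrable ?P (\<lambda>x. f x * q as x)" if "as \<in> ?S" "integrable ?P f"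
    for as and f :: "(nat \<times> nat \<Rightarrow> real) \<Rightarrow> real"
  proof (rule Bochner_Integration.integrable_bound[OF that(2)])
    show "(\<lambda>x. f x * q as x) \<in> borel_measurable ?P"
      using that by (intro borel_measurable_times q_meas) auto
    show "AE x in ?P. norm (f x * q as x) \<le> norm (f x)"
      using q01 by (auto simp: abs_mult intro!: mult_left_le)
  qed
  have weight: "weight as = (\<integral>x. q as x \<partial>?P)" if "as \<in> ?S" for as
    using weight_eq_cells[OF that] by (simp add: q_def)
  have weight': "run'.weight as = (\<integral>x. L x * q as x \<partial>?P)" if "as \<in> ?S" for as
    using run'.weight_eq_cells[OF that] L0 q_meas[OF that]
    by (simp add: PiM' integral_real_density L_meas flip: q_def)
  have sum_q: "(\<Sum>as\<in>?S. q as x) = 1" for x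
    by (simp add: q_def sum_acts)
  have one_int: "integrable ?P (\<lambda>x. 1 - L x)" using L_int by simp
  have sq_int: "integrable ?P (\<lambda>x. (1 - L x)\<^sup>2)"
    using L_int L2_int by (simp add: power2_diff)
  have sq: "(\<integral>x. (1 - L x)\<^sup>2 \<partial>?P) = (\<integral>x. (L x)\<^sup>2 \<partial>?P) - 1"
    using L_int L2_int by (simp add: power2_diff EL P.prob_space)
  have diff: "weight as - run'.weight as = (\<integral>x. (1 - L x) * q as x \<partial>?P)" if "as \<in> ?S" for as
    using q_int[OF that, of "\<lambda>_. 1"] q_int[OF that L_int]
    by (simp add: weight weight' that left_diff_distrib)
  \<comment> \<open>Both families of weights sum to 1, so \<open>h\<close> may be centred at
    \<open>c\<close> without changing the difference.\<close>
  have "(\<Sum>as\<in>?S. h as * weight as) - (\<Sum>as\<in>?S. h as * run'.weight as)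
      = (\<Sum>as\<in>?S. (h as - c) * (weight as - run'.weight as))"
    by (simp add: algebra_simps sum_subtractf sum.distrib sum_weight run'.sum_weight flip: sum_distrib_left)
  also have "\<dots> = (\<Sum>as\<in>?S. \<integral>x. (h as - c) * ((1 - L x) * q as x) \<partial>?P)"
    by (intro sum.cong refl) (simp add: diff)
  also have "\<dots> \<le> (\<Sum>as\<in>?S. \<integral>x. (lam / 2 * (h as - c)\<^sup>2 + (1 - L x)\<^sup>2 / (2 * lam)) * q as x \<partial>?P)"
  proof (intro sum_mono integral_mono)
    fix as x assume as: "as \<in> ?S"
    show "integrable ?P (\<lambda>x. (h as - c) * ((1 - L x) * q as x))"
      using q_int[OF as one_int] by simp
    show "integrable ?P (\<lambda>x. (lam / 2 * (h as - c)\<^sup>2 + (1 - L x)\<^sup>2 / (2 * lam)) * q as x)"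
      using sq_int by (intro q_int[OF as]) simp
    have "0 \<le> (lam * (h as - c) - (1 - L x))\<^sup>2 / (2 * lam)" using lam by simp
    also have "\<dots> = lam / 2 * (h as - c)\<^sup>2 + (1 - L x)\<^sup>2 / (2 * lam) - (h as - c) * (1 - L x)"
      using lam by (simp add: power2_eq_square field_simps)
    finally show "(h as - c) * ((1 - L x) * q as x)
        \<le> (lam / 2 * (h as - c)\<^sup>2 + (1 - L x)\<^sup>2 / (2 * lam)) * q as x"
      using q01(1)[of as x] mult_right_mono[of "(h as - c) * (1 - L x)" _ "q as x"] by (simp add: mult.assoc)
  qed
  also have "\<dots> = (\<Sum>as\<in>?S. lam / 2 * ((h as - c)\<^sup>2 * weight as) + (\<integral>x. (1 - L x)\<^sup>2 * q as x \<partial>?P) / (2 * lam))"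
  proof (intro sum.cong refl)
    fix as assume as: "as \<in> ?S"
    have "(\<integral>x. (lam / 2 * (h as - c)\<^sup>2 + (1 - L x)\<^sup>2 / (2 * lam)) * q as x \<partial>?P)
        = (\<integral>x. lam / 2 * (h as - c)\<^sup>2 * q as x + (1 - L x)\<^sup>2 * q as x / (2 * lam) \<partial>?P)"
      by (simp add: algebra_simps add_divide_distrib)
    also have "\<dots> = lam / 2 * ((h as - c)\<^sup>2 * weight as) + (\<integral>x. (1 - L x)\<^sup>2 * q as x \<partial>?P) / (2 * lam)"
      using q_int[OF as, of "\<lambda>_. 1"] q_int[OF as sq_int] by (simp add: weight[OF as])
    finally show "(\<integral>x. (lam / 2 * (h as - c)\<^sup>2 + (1 - L x)\<^sup>2 / (2 * lam)) * q as x \<partial>?P)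
        = lam / 2 * ((h as - c)\<^sup>2 * weight as) + (\<integral>x. (1 - L x)\<^sup>2 * q as x \<partial>?P) / (2 * lam)" .
  qed
  also have "\<dots> = lam / 2 * (\<Sum>as\<in>?S. (h as - c)\<^sup>2 * weight as)
      + (\<Sum>as\<in>?S. \<integral>x. (1 - L x)\<^sup>2 * q as x \<partial>?P) / (2 * lam)"
    by (simp only: sum.distrib sum_distrib_left sum_divide_distrib)
  \<comment> \<open>For each table the conditional probabilities \<open>q as x\<close> sum to 1, so
    summing over actions leaves exactly the chi-square divergence of the truncated tables.\<close>
  also have "(\<Sum>as\<in>?S. \<integral>x. (1 - L x)\<^sup>2 * q as x \<partial>?P) = (\<integral>x. (\<Sum>as\<in>?S. (1 - L x)\<^sup>2 * q as x) \<partial>?P)"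
    using q_int[OF _ sq_int] by (simp add: Bochner_Integration.integral_sum)
  also have "\<dots> = (\<Prod>i\<in>{1..K}. \<integral>x. (l i x)\<^sup>2 \<partial>\<nu> i) ^ T - 1"
    by (simp add: sum_q sq L2 flip: sum_distrib_left)
  finally show ?thesis .
qed

end

section \<open>Two coins\<close>

definition coin :: "real \<Rightarrow> real \<Rightarrow> real measure" where
  "coin b p = distr (measure_pmf (bernoulli_pmf p)) borel (\<lambda>c. if c then b else - b)"

lemma prob_space_coin: "prob_space (coin b p)"
  unfolding coin_def by (rule measure_pmf.prob_space_distr) simp

lemma sets_coin [simp]: "sets (coin b p) = sets borel"
  by (simp add: coin_def)

lemma integrable_coin:
  fixes f :: "real \<Rightarrow> real"
  assumes "f \<in> borel_measurable borel" shows "integrable (coin b p) f"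
  unfolding coin_def using assms
  by (subst integrable_distr_eq) (auto intro: integrable_measure_pmf_finite)

lemma integral_coin:
  fixes f :: "real \<Rightarrow> real"
  assumes "f \<in> borel_measurable borel" "0 \<le> p" "p \<le> 1"
  shows "(\<integral>x. f x \<partial>coin b p) = p * f b + (1 - p) * f (- b)"
  unfolding coin_def using assms by (subst integral_distr) (auto simp: mult.commute)

lemma mean_coin: "0 \<le> p \<Longrightarrow> p \<le> 1 \<Longrightarrow> mean (coin b p) = b * (2 * p - 1)"
  by (simp add: mean_def integral_coin algebra_simps)

text \<open>Hoeffding's lemma on an interval of width \<open>2 * b\<close> gives the exponent
  \<open>l\<^sup>2 * b\<^sup>2 / 2\<close>, and \<open>b\<close> is at most \<sigma>.\<close>

lemma subgaussian_coin:
  assumes b: "0 < b" "b \<le> \<sigma>"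
  shows "subgaussian \<sigma> (coin b p)"
proof -
  interpret coin: prob_space "coin b p" by (rule prob_space_coin)
  have ae: "AE x in coin b p. x \<in> {-b..b}"
    unfolding coin_def using b by (subst AE_distr_iff) auto
  interpret X: interval_bounded_random_variable "coin b p" "\<lambda>x. x" "-b" b
    by unfold_locales (use ae in \<open>auto simp: coin_def\<close>)
  \<comment> \<open>Hoeffding's lemma is applied for positive exponents; the mirrored variable
    handles negative \<open>l\<close>.\<close>
  interpret X': interval_bounded_random_variable "coin b p" "\<lambda>x. - x" "-b" b
    by unfold_locales (use ae in \<open>auto simp: coin_def\<close>)
  let ?m = "mean (coin b p)"
  have bound: "(\<integral>x. exp (l * (x - ?m)) \<partial>coin b p) \<le> exp (l\<^sup>2 * \<sigma>\<^sup>2 / 2)" for l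
  proof -
    have int: "integrable (coin b p) (\<lambda>x. exp (l * (x - ?m)))"
      by (rule integrable_coin) simp
    have "(\<integral>\<^sup>+x. exp (l * (x - ?m)) \<partial>coin b p) \<le> ennreal (exp (l\<^sup>2 * (b - (-b))\<^sup>2 / 8))"
    proof (cases l "0 :: real" rule: linorder_cases)
      case greater
      from X.Hoeffdings_lemma_nn_integral[OF this] show ?thesis by (simp add: mean_def)
    next
      case equal
      then show ?thesis by (simp add: coin.emeasure_space_1)
    next
      case less
      then have "0 < - l" by simp
      from X'.Hoeffdings_lemma_nn_integral[OF this] show ?thesis
        by (simp add: mean_def algebra_simps)
    qed
    also have "(\<integral>\<^sup>+x. exp (l * (x - ?m)) \<partial>coin b p) = ennreal (\<integral>x. exp (l * (x - ?m)) \<partial>coin b p)"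
      by (rule nn_integral_eq_integral[OF int]) simp
    finally have "(\<integral>x. exp (l * (x - ?m)) \<partial>coin b p) \<le> exp (l\<^sup>2 * (b - (-b))\<^sup>2 / 8)"
      by simp
    also have "\<dots> = exp (l\<^sup>2 * b\<^sup>2 / 2)" by (simp add: power_mult_distrib)
    also have "\<dots> \<le> exp (l\<^sup>2 * \<sigma>\<^sup>2 / 2)"
      using b by (simp add: mult_left_mono power_mono divide_right_mono)
    finally show ?thesis .
  qed
  show ?thesis
    unfolding subgaussian_def by (intro conjI allI bound integrable_coin) simp_all
qed

text \<open>The likelihood ratio of \<open>coin b p'\<close> against \<open>coin b p\<close>. The
  coin shows only \<open>b\<close> and \<open>- b\<close>, so the second branch is in effect the
  value at \<open>- b\<close>.\<close>

definition coin_ratio :: "real \<Rightarrow> real \<Rightarrow> real \<Rightarrow> real \<Rightarrow> real" where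
  "coin_ratio b p p' x = (if x = b then p' / p else (1 - p') / (1 - p))"

lemma coin_ratio_measurable [measurable]: "coin_ratio b p p' \<in> borel_measurable borel"
  unfolding coin_ratio_def[abs_def] by measurable

lemma coin_density:
  assumes "0 < b" "0 < p" "p < 1" "0 \<le> p'" "p' \<le> 1"
  shows "coin b p' = density (coin b p) (\<lambda>x. ennreal (coin_ratio b p p' x))"
proof (rule measure_eqI)
  fix A assume "A \<in> sets (coin b p')"
  then have A [measurable]: "A \<in> sets borel" by simp
  have "emeasure (density (coin b p) (\<lambda>x. ennreal (coin_ratio b p p' x))) A
      = (\<integral>\<^sup>+x. ennreal (coin_ratio b p p' x) * indicator A x \<partial>coin b p)"
    by (rule emeasure_density) (simp_all add: coin_def)
  also have "\<dots> = ennreal (p' / p) * indicator A b * p + ennreal ((1 - p') / (1 - p)) * indicator A (- b) * (1 - p)"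
    unfolding coin_def using assms by (subst nn_integral_distr) (simp_all add: coin_ratio_def)
  also have "\<dots> = indicator A b * ennreal p' + indicator A (- b) * ennreal (1 - p')"
    using assms by (simp add: ennreal_mult'[symmetric] mult_ac indicator_def)
  also have "\<dots> = (\<integral>\<^sup>+x. indicator A x \<partial>coin b p')"
    unfolding coin_def using assms by (subst nn_integral_distr) simp_all
  finally show "emeasure (coin b p') A = emeasure (density (coin b p) (\<lambda>x. ennreal (coin_ratio b p p' x))) A"
    by simp
qed simp

text \<open>The excess over 1 is the chi-square divergence of two Bernoulli laws; it is quadratic in
  the change of parameter.\<close>

lemma integral_coin_ratio_sq:
  assumes "0 < b" "0 < p" "p < 1"
  shows "(\<integral>x. (coin_ratio b p p' x)\<^sup>2 \<partial>coin b p) = 1 + (p' - p)\<^sup>2 / (p * (1 - p))"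
proof -
  have "(\<integral>x. (coin_ratio b p p' x)\<^sup>2 \<partial>coin b p) = p * (p' / p)\<^sup>2 + (1 - p) * ((1 - p') / (1 - p))\<^sup>2"
    using assms by (subst integral_coin) (auto simp: coin_ratio_def)
  also have "\<dots> = 1 + (p' - p)\<^sup>2 / (p * (1 - p))"
  proof -
    have "p * (p' / p)\<^sup>2 = p'\<^sup>2 / p" "(1 - p) * ((1 - p') / (1 - p))\<^sup>2 = (1 - p')\<^sup>2 / (1 - p)"
      using assms by (simp_all add: power2_eq_square)
    then show ?thesis
      using assms by (simp add: divide_simps) (simp add: power2_eq_square algebra_simps)
  qed
  finally show ?thesis .
qed

section \<open>The two-armed instances along the parameter \<theta>\<close>

definition two_coins :: "real \<Rightarrow> real \<Rightarrow> instance_laws" where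
  "two_coins b \<theta> i = coin b (if i = 2 then 1 / 2 - \<theta> else 1 / 2)"

lemma two_arms: "{1..2 :: nat} = {1, 2}" by auto

lemma bandit_run_two_coins: "bandit_algorithm \<pi> \<Longrightarrow> bandit_run \<pi> 2 (two_coins b \<theta>)"
  by (intro bandit_run.intro bandit_rule.intro bandit_run_axioms.intro)
    (simp_all add: two_coins_def prob_space_coin)

lemma two_coins_in_P_sg:
  assumes "0 < b" "b \<le> M" "b \<le> \<sigma>" "2 \<le> Kbar" "0 \<le> \<theta>" "\<theta> \<le> 1 / 4"
  shows "(2, two_coins b \<theta>) \<in> P_sg M \<sigma> Kbar"
proof -
  have "b * (2 * \<theta>) \<le> b * 1" using assms by (intro mult_left_mono) auto
  then have up: "2 * (b * \<theta>) \<le> M" using assms by linarith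
  have low: "0 \<le> b * \<theta>" using assms by simp
  have "mean (two_coins b \<theta> i) = (if i = 2 then - (2 * (b * \<theta>)) else 0)" for i
    using assms by (simp add: two_coins_def mean_coin algebra_simps)
  then have "mean (two_coins b \<theta> i) \<in> {-M..M}" for i
    using assms(1,2) up low by (simp; linarith)
  then show ?thesis
    using assms by (simp add: P_sg_def two_coins_def prob_space_coin subgaussian_coin)
qed

lemma regret_two_coins:
  assumes "0 < b" "0 \<le> \<theta>" "\<theta> \<le> 1 / 4"
  shows "regret \<pi> T 2 (two_coins b \<theta>) = 2 * b * \<theta> * expected_pulls \<pi> T 2 (two_coins b \<theta>) 2"
proof -
  have means: "mean (two_coins b \<theta> 1) = 0" "mean (two_coins b \<theta> 2) = - (2 * b * \<theta>)"
    using assms by (simp_all add: two_coins_def mean_coin algebra_simps)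
  have "(MAX j\<in>{1..2}. mean (two_coins b \<theta> j)) = 0"
    unfolding two_arms using assms by (simp add: means[unfolded One_nat_def])
  then have "gap 2 (two_coins b \<theta>) 1 = 0" "gap 2 (two_coins b \<theta>) 2 = 2 * b * \<theta>"
    by (simp_all only: gap_def means)
  then show ?thesis unfolding regret_def two_arms by simp
qed

text \<open>With \<open>y = real n * x\<close> in the unit interval, the power is at most
  \<open>exp y\<close>, hence at most \<open>1 + y + y\<^sup>2\<close> and so at most
  \<open>1 + 2 * y\<close>.\<close>

lemma power_le_of_small:
  fixes x :: real
  assumes "0 \<le> x" "real n * x \<le> 1"
  shows "(1 + x) ^ n - 1 \<le> 2 * (real n * x)"
proof -
  have "(1 + x) ^ n \<le> exp x ^ n" using assms by (intro power_mono) auto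
  also have "\<dots> = exp (real n * x)" by (simp add: exp_of_nat_mult)
  also have "\<dots> \<le> 1 + real n * x + (real n * x)\<^sup>2" using assms by (intro exp_bound) auto
  also have "\<dots> \<le> 1 + real n * x + real n * x"
    unfolding power2_eq_square by (intro add_left_mono mult_left_le) (use assms in auto)
  finally show ?thesis by (simp add: mult.commute)
qed

text \<open>This is \<open>change_of_measure\<close> with \<open>c\<close> the expected number of
  pulls of arm 2 and \<open>lam = \<eta>\<close>. The divergence is of order
  \<open>T * \<eta>\<^sup>2\<close>, so dividing it by \<eta> makes both error terms linear in
  \<eta>, and steps can be added up.\<close>

lemma two_coins_step:
  assumes alg: "bandit_algorithm \<pi>" and b: "0 < b"
    and \<theta>: "0 \<le> \<theta>" "\<theta> + \<eta> \<le> 1 / 4" and \<eta>: "0 < \<eta>" "real T * (8 * \<eta>\<^sup>2) \<le> 1"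
  shows "expected_pulls \<pi> T 2 (two_coins b \<theta>) 2 - expected_pulls \<pi> T 2 (two_coins b (\<theta> + \<eta>)) 2
     \<le> \<eta> / 2 * variance_pulls \<pi> T 2 (two_coins b \<theta>) 2 + 8 * real T * \<eta>"
proof -
  interpret run: bandit_run \<pi> T 2 "two_coins b \<theta>" by (rule bandit_run_two_coins[OF alg])
  interpret run': bandit_run \<pi> T 2 "two_coins b (\<theta> + \<eta>)" by (rule bandit_run_two_coins[OF alg])
  define p where "p = 1 / 2 - \<theta>"
  define p' where "p' = 1 / 2 - (\<theta> + \<eta>)"
  have p: "1 / 4 \<le> p" "p \<le> 1 / 2" "0 \<le> p'" "p' \<le> 1" using \<theta> \<eta> by (auto simp: p_def p'_def)
  \<comment> \<open>The other arm keeps its law: its ratio is constantly 1, written as a coin ratio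
    so that both arms share the density lemma.\<close>
  define l where "l i = (if i = (2 :: nat) then coin_ratio b p p' else coin_ratio b (1/2) (1/2))" for i
  have dens: "two_coins b (\<theta> + \<eta>) i = density (two_coins b \<theta> i) (\<lambda>x. ennreal (l i x))" for i
    using coin_density[OF b, of p p'] coin_density[OF b, of "1/2" "1/2"] p
    by (simp add: two_coins_def l_def p_def p'_def)
  have l_meas: "l i \<in> borel_measurable borel" for i by (simp add: l_def)
  have l0: "0 \<le> l i x" for i x using p by (simp add: l_def coin_ratio_def)
  have l2: "integrable (two_coins b \<theta> i) (\<lambda>x. (l i x)\<^sup>2)" for i
    unfolding two_coins_def using l_meas by (intro integrable_coin) simp
  define \<kappa> where "\<kappa> = \<eta>\<^sup>2 / (p * (1 - p))"
  have "(\<integral>x. (l 1 x)\<^sup>2 \<partial>two_coins b \<theta> 1) = 1"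
    using integral_coin_ratio_sq[OF b, of "1/2" "1/2"] by (simp add: l_def two_coins_def)
  moreover have "(\<integral>x. (l 2 x)\<^sup>2 \<partial>two_coins b \<theta> 2) = 1 + \<kappa>"
    using integral_coin_ratio_sq[OF b, of p p'] p
    by (simp add: l_def two_coins_def p_def p'_def \<kappa>_def)
  ultimately have prod: "(\<Prod>i\<in>{1..2}. \<integral>x. (l i x)\<^sup>2 \<partial>two_coins b \<theta> i) = 1 + \<kappa>"
    unfolding two_arms by simp
  have \<kappa>0: "0 \<le> \<kappa>" using p by (simp add: \<kappa>_def)
  \<comment> \<open>Here \<open>p\<close> is at least 1/4 and \<open>1 - p\<close> at least 1/2;
    their product 1/8 is the source of the constant 8.\<close>
  have "1 / 4 * (1 / 2) \<le> p * (1 - p)" using p by (intro mult_mono) auto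
  then have "\<kappa> \<le> \<eta>\<^sup>2 / (1 / 8)" unfolding \<kappa>_def by (intro divide_left_mono) auto
  then have \<kappa>: "\<kappa> \<le> 8 * \<eta>\<^sup>2" by simp
  then have "real T * \<kappa> \<le> real T * (8 * \<eta>\<^sup>2)" by (intro mult_left_mono) auto
  then have "(1 + \<kappa>) ^ T - 1 \<le> 2 * (real T * (8 * \<eta>\<^sup>2))"
    using power_le_of_small[OF \<kappa>0, of T] \<eta>(2) by linarith
  then have "((1 + \<kappa>) ^ T - 1) / (2 * \<eta>) \<le> 2 * (real T * (8 * \<eta>\<^sup>2)) / (2 * \<eta>)"
    using \<eta> by (intro divide_right_mono) auto
  also have "\<dots> = 8 * real T * \<eta>" using \<eta> by (simp add: power2_eq_square)
  finally have chi2: "((1 + \<kappa>) ^ T - 1) / (2 * \<eta>) \<le> 8 * real T * \<eta>" .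
  have "expected_pulls \<pi> T 2 (two_coins b \<theta>) 2 - expected_pulls \<pi> T 2 (two_coins b (\<theta> + \<eta>)) 2
      \<le> \<eta> / 2 * variance_pulls \<pi> T 2 (two_coins b \<theta>) 2 + ((1 + \<kappa>) ^ T - 1) / (2 * \<eta>)"
    unfolding run.expected_pulls_eq run'.expected_pulls_eq run.variance_pulls_eq prod[symmetric]
    by (rule run.change_of_measure[OF run'.bandit_run_axioms dens l_meas l0 l2 \<eta>(1)])
  with chi2 show ?thesis by linarith
qed

section \<open>Uniform bounds on regret and variability, and comparison with the suprema\<close>

lemma bandit_run_P_sg:
  assumes "bandit_algorithm \<pi>" "(K, \<nu>) \<in> P_sg M \<sigma> Kbar"
  shows "bandit_run \<pi> K \<nu>"
  using assms by (intro bandit_run.intro bandit_rule.intro bandit_run_axioms.intro) (auto simp: P_sg_def)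

text \<open>Means in \<open>{-M..M}\<close> keep every gap at most \<open>2 * M\<close>, and the
  expected pulls sum to \<open>T\<close>.\<close>

lemma regret_le:
  assumes alg: "bandit_algorithm \<pi>" and \<nu>: "(K, \<nu>) \<in> P_sg M \<sigma> Kbar"
  shows "regret \<pi> T K \<nu> \<le> 2 * M * real T"
proof -
  interpret bandit_run \<pi> T K \<nu> by (rule bandit_run_P_sg[OF alg \<nu>])
  have "gap K \<nu> i \<le> 2 * M" if i: "i \<in> {1..K}" for i
  proof -
    have "(MAX j\<in>{1..K}. mean (\<nu> j)) \<le> M"
      using \<nu> i by (intro Max.boundedI) (auto simp: P_sg_def)
    moreover have "- M \<le> mean (\<nu> i)" using \<nu> i by (auto simp: P_sg_def)
    ultimately show ?thesis by (simp add: gap_def)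
  qed
  then have "regret \<pi> T K \<nu> \<le> (\<Sum>i\<in>{1..K}. 2 * M * expected_pulls \<pi> T K \<nu> i)"
    unfolding regret_def by (intro sum_mono mult_right_mono expected_pulls_bounds)
  also have "\<dots> = 2 * M * real T"
    by (simp only: sum_expected_pulls flip: sum_distrib_left)
  finally show ?thesis .
qed

lemma variability_le:
  assumes alg: "bandit_algorithm \<pi>" and \<nu>: "(K, \<nu>) \<in> P_sg M \<sigma> Kbar"
  shows "variability \<pi> T K \<nu> \<le> real T"
proof -
  interpret bandit_run \<pi> T K \<nu> by (rule bandit_run_P_sg[OF alg \<nu>])
  have "sqrt (variance_pulls \<pi> T K \<nu> i) \<le> real T" for i
    using variance_pulls_bounds(2)[of i] by (intro real_le_lsqrt[OF _ _]) auto
  then show ?thesis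
    unfolding variability_def using K by (intro Max.boundedI) auto
qed

text \<open>A real supremum dominates its members only over a set bounded above;
  \<open>regret_le\<close> supplies a bound uniform over the class.\<close>

lemma regret_le_sup_regret:
  assumes "bandit_algorithm \<pi>" "(K, \<nu>) \<in> P_sg M \<sigma> Kbar"
  shows "regret \<pi> T K \<nu> \<le> sup_regret M \<sigma> Kbar \<pi> T"
proof -
  have "bdd_above ((\<lambda>(K, \<nu>). regret \<pi> T K \<nu>) ` P_sg M \<sigma> Kbar)"
    by (rule bdd_aboveI2[where M = "2 * M * real T"]) (auto intro: regret_le[OF assms(1)])
  from cSUP_upper[OF assms(2) this] show ?thesis by (simp add: sup_regret_def)
qed

lemma sqrt_variance_le_sup_variability:
  assumes alg: "bandit_algorithm \<pi>" and \<nu>: "(K, \<nu>) \<in> P_sg M \<sigma> Kbar" and i: "i \<in> {1..K}"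
  shows "sqrt (variance_pulls \<pi> T K \<nu> i) \<le> sup_variability M \<sigma> Kbar \<pi> T"
proof -
  have "bdd_above ((\<lambda>(K, \<nu>). variability \<pi> T K \<nu>) ` P_sg M \<sigma> Kbar)"
    by (rule bdd_aboveI2[where M = "real T"]) (auto intro: variability_le[OF alg])
  from cSUP_upper[OF \<nu> this]
  have "variability \<pi> T K \<nu> \<le> sup_variability M \<sigma> Kbar \<pi> T" by (simp add: sup_variability_def)
  moreover have "sqrt (variance_pulls \<pi> T K \<nu> i) \<le> variability \<pi> T K \<nu>"
    unfolding variability_def using i by (intro Max_ge) auto
  ultimately show ?thesis by linarith
qed

text \<open>
  Cutting the interval of parameters into \<open>T\<close> steps makes the one-reward divergence \<open>\<kappa>\<close> of each step
  so small that \<open>(1 + \<kappa>)\<^sup>T - 1\<close> is of order \<open>T \<kappa>\<close>.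
\<close>

lemma two_coins_path:
  assumes alg: "bandit_algorithm \<pi>" and b: "0 < b" "b \<le> M" "b \<le> \<sigma>" and Kbar: "2 \<le> Kbar"
    and \<delta>: "0 < \<delta>" "\<delta> \<le> 1 / 4" and T: "1 \<le> T"
    and S: "sup_variability M \<sigma> Kbar \<pi> T \<le> Z * sqrt (real T)"
  shows "expected_pulls \<pi> T 2 (two_coins b 0) 2 - expected_pulls \<pi> T 2 (two_coins b \<delta>) 2
     \<le> \<delta> * real T * (Z\<^sup>2 / 2 + 8)"
proof -
  define \<eta> where "\<eta> = \<delta> / real T"
  define f where "f \<theta> = expected_pulls \<pi> T 2 (two_coins b \<theta>) 2" for \<theta>
  have T\<eta>: "real T * \<eta> = \<delta>" and \<eta>: "0 < \<eta>" using \<delta> T by (simp_all add: \<eta>_def)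
  have "\<eta> \<le> \<delta>" using \<delta> T unfolding \<eta>_def by (simp add: divide_le_eq mult_left_le)
  then have "\<delta> * \<eta> \<le> 1 / 4 * (1 / 4)" using \<delta> \<eta> by (intro mult_mono) auto
  \<comment> \<open>Since \<open>real T * \<eta> = \<delta>\<close>, the left side is
    \<open>8 * \<delta> * \<eta>\<close>, which is at most 1/2.\<close>
  then have small: "real T * (8 * \<eta>\<^sup>2) \<le> 1" by (simp add: power2_eq_square flip: T\<eta>)
  have step: "f (real k * \<eta>) - f (real (Suc k) * \<eta>) \<le> \<eta> * (real T * (Z\<^sup>2 / 2 + 8))" if k: "k < T" for k
  proof -
    define \<theta> where "\<theta> = real k * \<eta>"
    \<comment> \<open>From \<open>k < T\<close> the right end of the step is still at most \<delta>,
      so the whole step stays in the admissible range up to 1/4.\<close>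
    have "real (Suc k) * \<eta> \<le> real T * \<eta>" using k \<eta> by (intro mult_right_mono) auto
    then have le: "\<theta> + \<eta> \<le> 1 / 4" using T\<eta> \<delta> by (simp add: \<theta>_def algebra_simps)
    have \<theta>0: "0 \<le> \<theta>" using \<eta> by (simp add: \<theta>_def)
    have mem: "(2, two_coins b \<theta>) \<in> P_sg M \<sigma> Kbar"
      using b Kbar \<theta>0 le \<eta> by (intro two_coins_in_P_sg) auto
    interpret run: bandit_run \<pi> T 2 "two_coins b \<theta>" by (rule bandit_run_two_coins[OF alg])
    let ?V = "variance_pulls \<pi> T 2 (two_coins b \<theta>) 2"
    have "sqrt ?V \<le> Z * sqrt (real T)"
      using sqrt_variance_le_sup_variability[OF alg mem, of 2 T] S by simp
    then have "(sqrt ?V)\<^sup>2 \<le> (Z * sqrt (real T))\<^sup>2"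
      by (rule power_mono) (simp add: run.variance_pulls_bounds)
    then have V: "?V \<le> Z\<^sup>2 * real T"
      by (simp add: run.variance_pulls_bounds power_mult_distrib)
    have "f \<theta> - f (\<theta> + \<eta>) \<le> \<eta> / 2 * ?V + 8 * real T * \<eta>"
      unfolding f_def by (rule two_coins_step[OF alg b(1) \<theta>0 le \<eta> small])
    also have "\<dots> \<le> \<eta> / 2 * (Z\<^sup>2 * real T) + 8 * real T * \<eta>"
      using V \<eta> by (intro add_right_mono mult_left_mono) auto
    also have "\<dots> = \<eta> * (real T * (Z\<^sup>2 / 2 + 8))" by (simp add: algebra_simps)
    finally show ?thesis by (simp add: \<theta>_def algebra_simps)
  qed
  \<comment> \<open>The sum telescopes; its last argument \<open>real T * \<eta>\<close> is exactly
    \<delta>.\<close>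
  have "f 0 - f \<delta> = (\<Sum>k<T. f (real k * \<eta>) - f (real (Suc k) * \<eta>))"
    by (subst sum_lessThan_telescope') (simp add: T\<eta>)
  also have "\<dots> \<le> (\<Sum>k<T. \<eta> * (real T * (Z\<^sup>2 / 2 + 8)))"
    by (rule sum_mono) (use step in simp)
  also have "\<dots> = \<delta> * real T * (Z\<^sup>2 / 2 + 8)"
    by (simp flip: T\<eta>)
  finally show ?thesis by (simp add: f_def)
qed

section \<open>Conclusion: symmetry at 0 against sublinear regret at \<delta>\<close>

lemma symmetric_onD:
  assumes "symmetric_on P \<pi>" "(K, \<nu>) \<in> P" "i \<in> {1..K}" "j \<in> {1..K}" "i \<noteq> j" "\<nu> i = \<nu> j"
  shows "expected_pulls \<pi> T K \<nu> i = expected_pulls \<pi> T K \<nu> j"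
  using bspec[OF assms(1)[unfolded symmetric_on_def] assms(2)] assms(3-) unfolding prod.case by blast

theorem corollary2:
  fixes M \<sigma> :: real and Kbar :: nat and \<pi> :: algorithm
  assumes "0 < M" and "0 < \<sigma>" and "2 \<le> Kbar"
    and "bandit_algorithm \<pi>"
    and "symmetric_on (P_sg M \<sigma> Kbar) \<pi>"
    and "explores_all_on (P_sg M \<sigma> Kbar) \<pi>"
    and "active_learning M \<sigma> Kbar \<pi>"
  shows "filterlim (\<lambda>T. sup_variability M \<sigma> Kbar \<pi> T / sqrt (real T)) at_top sequentially"
  unfolding filterlim_at_top
proof
  fix Z :: real
  define b where "b = min M \<sigma>"
  have b: "0 < b" "b \<le> M" "b \<le> \<sigma>" using assms(1,2) by (auto simp: b_def)
  \<comment> \<open>Chosen so that the total drift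
    \<open>\<delta> * real T * (Z\<^sup>2 / 2 + 8)\<close> along the path equals
    \<open>real T / 8\<close>.\<close>
  define \<delta> where "\<delta> = 1 / (4 * Z\<^sup>2 + 64)"
  have pos: "0 < 4 * Z\<^sup>2 + 64" by (simp add: add_nonneg_pos)
  have \<delta>: "0 < \<delta>" "\<delta> \<le> 1 / 4" using pos by (simp_all add: \<delta>_def divide_le_eq)
  have \<delta>Z: "\<delta> * (Z\<^sup>2 / 2 + 8) = 1 / 8" using pos by (simp add: \<delta>_def field_simps)
  have mem: "(2, two_coins b \<theta>) \<in> P_sg M \<sigma> Kbar" if "0 \<le> \<theta>" "\<theta> \<le> 1 / 4" for \<theta>
    using b assms(3) that by (intro two_coins_in_P_sg) auto
  \<comment> \<open>The regret at \<delta> is \<open>2 * b * \<delta>\<close> times the expected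
    pulls of arm 2, so this threshold forces them below 3/8 of the horizon. From one half at
    parameter 0 the drop then exceeds \<open>real T / 8\<close>.\<close>
  have "\<forall>\<^sub>F T in sequentially. sup_regret M \<sigma> Kbar \<pi> T / real T < 3 / 4 * (b * \<delta>)"
    using assms(7) unfolding active_learning_def by (rule order_tendstoD) (use b \<delta> in simp)
  then show "\<forall>\<^sub>F T in sequentially. Z \<le> sup_variability M \<sigma> Kbar \<pi> T / sqrt (real T)"
    using eventually_ge_at_top[of 1]
  proof eventually_elim
    case (elim T)
    let ?f = "\<lambda>\<theta>. expected_pulls \<pi> T 2 (two_coins b \<theta>) 2"
    interpret run: bandit_run \<pi> T 2 "two_coins b 0" by (rule bandit_run_two_coins[OF assms(4)])
    have "two_coins b 0 1 = two_coins b 0 2" by (simp add: two_coins_def)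
    then have "expected_pulls \<pi> T 2 (two_coins b 0) 1 = ?f 0"
      using symmetric_onD[OF assms(5) mem[of 0], of 1 2 T] by simp
    then have f0: "?f 0 = real T / 2"
      using run.sum_expected_pulls unfolding two_arms by simp
    have "2 * b * \<delta> * ?f \<delta> \<le> sup_regret M \<sigma> Kbar \<pi> T"
      using regret_le_sup_regret[OF assms(4) mem[of \<delta>], of T] regret_two_coins[OF b(1), of \<delta> \<pi> T] \<delta> by simp
    also have "\<dots> < 3 / 4 * (b * \<delta>) * real T" using elim by (simp add: divide_less_eq)
    finally have "b * \<delta> * (2 * ?f \<delta>) < b * \<delta> * (3 / 4 * real T)" by (simp add: algebra_simps)
    then have f\<delta>: "?f \<delta> < 3 / 8 * real T" using b \<delta> by (simp add: mult_less_cancel_left)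
    have "Z * sqrt (real T) < sup_variability M \<sigma> Kbar \<pi> T"
    proof (rule ccontr)
      \<comment> \<open>The negation is the variability bound that \<open>two_coins_path\<close>
        asks for; it would limit the drop to \<open>real T / 8\<close>.\<close>
      assume "\<not> ?thesis"
      then have "?f 0 - ?f \<delta> \<le> \<delta> * real T * (Z\<^sup>2 / 2 + 8)"
        by (intro two_coins_path[OF assms(4) b assms(3) \<delta> elim(2)]) simp
      also have "\<dots> = real T / 8" using \<delta>Z by (simp add: mult.commute mult.left_commute)
      finally show False using f0 f\<delta> by simp
    qed
    then show ?case using elim by (simp add: le_divide_eq)
  qed
qed

end
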